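(* Let $G$ be a finite simple graph without isolated vertices. If $G$ is a block graph, then $\widetilde{G}$ is a chordal graph.
   Context: $\widetilde{G}$ is the second power of $G$: the graph with vertex set $V(G)$ and edge set $E(\widetilde{G})=E(G)\cup\{\{i,j\}: i\ne j,\ i,j\in N_G(p)\text{ for some }p\in V(G)\}$, where $N_G(p)$ is the open neighborhood of $p$. A block graph is a graph in which every block (maximal connected subgraph without a cut vertex) is a complete graph; it need not be connected. *)

theory Defs
  imports Graph_Theory.Graph_Theory
begin

text \<open>
  A finite simple graph is a \<^const>\<open>pair_graph\<close>: a finite vertex set together with a finite,
  symmetric, loop-free set of ordered pairs, the edge \<open>{u, v}\<close> being represented by the two pairs
  \<open>(u, v)\<close> and \<open>(v, u)\<close>.
\<close>

definition open_nbhd :: "'a pair_pre_digraph \<Rightarrow> 'a \<Rightarrow> 'a set" where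
  "open_nbhd G p = {v \<in> pverts G. (p, v) \<in> parcs G}"

definition no_isolated_verts :: "'a pair_pre_digraph \<Rightarrow> bool" where
  "no_isolated_verts G \<longleftrightarrow> (\<forall>v \<in> pverts G. open_nbhd G v \<noteq> {})"

definition second_power :: "'a pair_pre_digraph \<Rightarrow> 'a pair_pre_digraph" where
  "second_power G =
    \<lparr> pverts = pverts G,
      parcs = parcs G \<union>
        {(i, j). i \<noteq> j \<and> (\<exists>p \<in> pverts G. i \<in> open_nbhd G p \<and> j \<in> open_nbhd G p)} \<rparr>"

text \<open>
  A cut vertex of \<open>H\<close> is a vertex separating two other vertices of the same component of \<open>H\<close>.
\<close>

definition cut_vertex :: "('a, 'b) pre_digraph \<Rightarrow> 'a \<Rightarrow> bool" where
  "cut_vertex H v \<longleftrightarrow> v \<in> verts H \<and>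
    (\<exists>x \<in> verts H - {v}. \<exists>y \<in> verts H - {v}.
      x \<rightarrow>\<^sup>*\<^bsub>H\<^esub> y \<and> \<not> x \<rightarrow>\<^sup>*\<^bsub>pre_digraph.del_vert H v\<^esub> y)"

text \<open>
  The library's subgraph relation is the one for digraphs; the conjunct \<^const>\<open>graph\<close> restricts
  the competing subgraphs to those with symmetric arc set, that is, to subgraphs in the
  undirected sense.  The library's \<^const>\<open>connected\<close> excludes the null graph.
\<close>

definition block :: "'a pair_pre_digraph \<Rightarrow> ('a, 'a \<times> 'a) pre_digraph \<Rightarrow> bool" where
  "block G B \<longleftrightarrow>
    pre_digraph.max_subgraph (with_proj G)
      (\<lambda>H. graph H \<and> connected H \<and> (\<nexists>v. cut_vertex H v)) B"

definition block_graph :: "'a pair_pre_digraph \<Rightarrow> bool" where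
  "block_graph G \<longleftrightarrow> pair_graph G \<and> (\<forall>B. block G B \<longrightarrow> (\<exists>n. complete_digraph n B))"

text \<open>
  A cycle is given by its list of arcs, so its vertices are the first components of these arcs.
  A chord joins two vertices of the cycle but is not itself an edge of the cycle, in either
  orientation.  The degenerate closed walks \<open>u, v, u\<close>, which the library counts as cycles, have
  length 2 and are excluded by the length bound.
\<close>

definition chord :: "'a pair_pre_digraph \<Rightarrow> ('a \<times> 'a) awalk \<Rightarrow> 'a \<times> 'a \<Rightarrow> bool" where
  "chord G c e \<longleftrightarrow> e \<in> parcs G \<and> fst e \<in> fst ` set c \<and> snd e \<in> fst ` set c \<and>
    e \<notin> set c \<and> (snd e, fst e) \<notin> set c"

definition chordal :: "'a pair_pre_digraph \<Rightarrow> bool" where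
  "chordal G \<longleftrightarrow> pair_graph G \<and>
    (\<forall>c. pre_digraph.cycle (with_proj G) c \<and> length c \<ge> 4 \<longrightarrow> (\<exists>e. chord G c e))"

end

theory Submission
  imports Defs
begin

text \<open>
  The proof shows that, in the second power of a block graph, a vertex \<open>v\<close> that is at maximal
  distance from a root \<open>r\<close> is simplicial: any two of its neighbours are adjacent.  Applied inside
  a cycle of length at least 4, with \<open>r\<close> on the cycle and \<open>v\<close> a vertex of the cycle farthest
  from \<open>r\<close>, this gives a chord between the two cycle neighbours of \<open>v\<close>.  Distances are those
  of \<open>G\<close>, which is harmless because every edge of the second power joins vertices of the same
  component of \<open>G\<close>.

  Block graphs enter through a single local property: two neighbours of a vertex \<open>w\<close> that are
  linked by a path avoiding \<open>w\<close> are adjacent (\<open>block_graph_cycle_clique_relation\<close>).  Indeed \<open>w\<close>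
  and the path form a cycle, the subgraph that its vertices induce has no cut vertex, and so it
  lies in a block, which is complete.

  This property makes the distance levels from \<open>r\<close> look like those of a tree.  Two neighbours of
  \<open>w\<close> that are not farther than \<open>w\<close> are linked through \<open>r\<close> by shortest paths avoiding \<open>w\<close>, so
  they are adjacent (\<open>inward_neighbours_adjacent\<close>).  Hence adjacent vertices of one level have
  the same neighbours on the level below, and every vertex other than \<open>r\<close> has exactly one such
  neighbour, its parent (\<open>parent_unique\<close>).  It follows that every vertex within distance 2 of
  \<open>v\<close> that is not farther from \<open>r\<close> than \<open>v\<close> lies in the closed neighbourhood of the parent of
  \<open>v\<close> (\<open>second_neighbour_in_parent_ball\<close>), and any two vertices of a closed neighbourhood are
  within distance 2 of each other.
\<close>

section \<open>Distance levels in a graph whose cycles span cliques\<close>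

text \<open>
  The distance from \<open>r\<close> to \<open>x\<close>; it is meaningful only for \<open>x\<close> reachable from \<open>r\<close>.
\<close>

definition level :: "'a rel \<Rightarrow> 'a \<Rightarrow> 'a \<Rightarrow> nat" where
  "level E r x = (LEAST n. (r, x) \<in> E ^^ n)"

lemma level_le: "(r, x) \<in> E ^^ n \<Longrightarrow> level E r x \<le> n"
  unfolding level_def by (rule Least_le)

lemma relpow_level: "(r, x) \<in> E\<^sup>* \<Longrightarrow> (r, x) \<in> E ^^ level E r x"
  unfolding level_def by (rule LeastI_ex) (rule rtrancl_imp_relpow)

lemma level_eq_0D: "(r, x) \<in> E\<^sup>* \<Longrightarrow> level E r x = 0 \<Longrightarrow> x = r"
  using relpow_level[of r x E] by simp

lemma level_edge_le:
  assumes "(r, x) \<in> E\<^sup>*" "(x, y) \<in> E"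
  shows "level E r y \<le> Suc (level E r x)"
  using relpow_level[OF assms(1)] assms(2) by (auto intro!: level_le)

lemma obtain_parent:
  assumes "(r, x) \<in> E\<^sup>*" "level E r x = Suc n"
  obtains p where "(p, x) \<in> E" "(r, p) \<in> E\<^sup>*" "level E r p = n"
proof -
  have "(r, x) \<in> E ^^ Suc n"
    using relpow_level[OF assms(1)] assms(2) by simp
  then obtain p where p: "(r, p) \<in> E ^^ n" "(p, x) \<in> E"
    by auto
  have reach: "(r, p) \<in> E\<^sup>*"
    using p(1) by (rule relpow_imp_rtrancl)
  have "level E r p = n"
    using level_le[OF p(1)] level_edge_le[OF reach p(2)] assms(2) by simp
  with that p(2) reach show ?thesis by blast
qed

text \<open>
  A shortest path from \<open>r\<close> to \<open>x\<close> climbs one level at a time, so it avoids all vertices other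
  than \<open>x\<close> that are at least as far from \<open>r\<close> as \<open>x\<close>.
\<close>

lemma descending_path:
  assumes "(r, x) \<in> E\<^sup>*"
  shows "(r, x) \<in> rtrancl_on (insert x {y. level E r y < level E r x}) E"
  using assms
proof (induction "level E r x" arbitrary: x)
  case 0
  then show ?case using level_eq_0D[of r x E] by auto
next
  case (Suc n)
  obtain p where p: "(p, x) \<in> E" "(r, p) \<in> E\<^sup>*" "level E r p = n"
    using obtain_parent[of r x E n] Suc.prems Suc.hyps(2) by metis
  have "insert p {y. level E r y < level E r p}
      \<subseteq> insert x {y. level E r y < level E r x}"
    using p(3) Suc.hyps(2) by auto
  with Suc.hyps(1)[of p] p have "(r, p) \<in> rtrancl_on (insert x {y. level E r y < level E r x}) E"
    by (blast intro: rtrancl_on_mono)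
  with p(1) show ?case by (auto intro: rtrancl_on_into_rtrancl_on)
qed

text \<open>
  The locale isolates what is used about block graphs.  The last assumption says that the
  two neighbours of a vertex on a cycle are adjacent; a walk that avoids \<open>w\<close> stands for the rest
  of the cycle, which spares the users of the locale from producing paths without repetitions.
\<close>

locale cycle_clique_relation =
  fixes E :: "'a rel"
  assumes sym_E: "sym E"
    and irrefl_E: "(x, x) \<notin> E"
    and linked_neighbours_adjacent:
      "(w, u) \<in> E \<Longrightarrow> (w, v) \<in> E \<Longrightarrow> u \<noteq> v \<Longrightarrow> (u, v) \<in> rtrancl_on (- {w}) E
        \<Longrightarrow> (u, v) \<in> E"
begin

lemma symD_E: "(x, y) \<in> E \<Longrightarrow> (y, x) \<in> E"
  using sym_E by (rule symD)

lemma reach_edge: "(r, x) \<in> E\<^sup>* \<Longrightarrow> (x, y) \<in> E \<Longrightarrow> (r, y) \<in> E\<^sup>*"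
  by (rule rtrancl_into_rtrancl)

text \<open>
  Shortest paths from \<open>a\<close> and \<open>b\<close> to the root avoid \<open>w\<close>, so together they link \<open>a\<close> and \<open>b\<close>
  around \<open>w\<close>.
\<close>

lemma inward_neighbours_adjacent:
  assumes w: "(r, w) \<in> E\<^sup>*" and E: "(w, a) \<in> E" "(w, b) \<in> E" and "a \<noteq> b"
    and le: "level E r a \<le> level E r w" "level E r b \<le> level E r w"
  shows "(a, b) \<in> E"
proof -
  have from_root: "(r, c) \<in> rtrancl_on (- {w}) E"
    if "(w, c) \<in> E" "level E r c \<le> level E r w" for c
  proof -
    have "w \<noteq> c" using that irrefl_E by auto
    with that(2) have "insert c {y. level E r y < level E r c} \<subseteq> - {w}"
      by auto
    with descending_path[OF reach_edge[OF w that(1)]] show ?thesis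
      by (blast intro: rtrancl_on_mono)
  qed
  have "(a, r) \<in> rtrancl_on (- {w}) E"
    using from_root[OF E(1) le(1)] rtrancl_on_sym[OF sym_E] by (blast dest: symD)
  then have "(a, b) \<in> rtrancl_on (- {w}) E"
    using from_root[OF E(2) le(2)] by (rule rtrancl_on_trans)
  with E \<open>a \<noteq> b\<close> show ?thesis by (rule linked_neighbours_adjacent)
qed

lemma parent_of_level_neighbour:
  assumes "(r, u) \<in> E\<^sup>*" "(u, v) \<in> E" "level E r u = level E r v"
    and "(p, u) \<in> E" "level E r u = Suc (level E r p)"
  shows "(p, v) \<in> E"
proof -
  have "p \<noteq> v" using assms(3,5) by auto
  then show ?thesis
    using inward_neighbours_adjacent[OF assms(1) symD_E[OF assms(4)] assms(2)] assms(3,5) by simp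
qed

text \<open>
  Two parents \<open>p\<close> and \<open>q\<close> of \<open>v\<close> would be adjacent and on the same level, hence would share a
  parent \<open>w\<close>.  Then \<open>w - q - v\<close> links the neighbours \<open>w\<close> and \<open>v\<close> of \<open>p\<close> around \<open>p\<close>, so \<open>w\<close>
  and \<open>v\<close> would be adjacent although their levels differ by 2.
\<close>

lemma parent_unique:
  assumes v: "(r, v) \<in> E\<^sup>*" and E: "(p, v) \<in> E" "(q, v) \<in> E"
    and lp: "level E r v = Suc (level E r p)" and lq: "level E r v = Suc (level E r q)"
  shows "p = q"
proof (rule ccontr)
  assume "p \<noteq> q"
  have reach: "(r, p) \<in> E\<^sup>*" "(r, q) \<in> E\<^sup>*"
    using v E by (metis reach_edge symD_E)+
  have "(p, q) \<in> E"
    using inward_neighbours_adjacent[OF v symD_E[OF E(1)] symD_E[OF E(2)] \<open>p \<noteq> q\<close>] lp lq by simp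
  show False
  proof (cases "level E r p")
    case 0
    with lp lq reach \<open>p \<noteq> q\<close> show False by (auto dest: level_eq_0D)
  next
    case (Suc n)
    then obtain w where w: "(w, p) \<in> E" "(r, w) \<in> E\<^sup>*" "level E r w = n"
      using obtain_parent[OF reach(1)] by metis
    have "(w, q) \<in> E"
      using parent_of_level_neighbour[OF reach(1) \<open>(p, q) \<in> E\<close> _ w(1)] lp lq Suc w(3) by simp
    have "w \<noteq> p" "v \<noteq> p" "w \<noteq> v"
      using lp w(3) Suc by auto
    then have "(w, w) \<in> rtrancl_on (- {p}) E" "q \<in> - {p}" "v \<in> - {p}"
      using \<open>p \<noteq> q\<close> by auto
    then have "(w, v) \<in> rtrancl_on (- {p}) E"
      using \<open>(w, q) \<in> E\<close> E(2) by (metis rtrancl_on_into_rtrancl_on)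
    then have "(w, v) \<in> E"
      by (rule linked_neighbours_adjacent[OF symD_E[OF w(1)] E(1) \<open>w \<noteq> v\<close>])
    then show False
      using level_edge_le[OF w(2)] lp Suc w(3) by fastforce
  qed
qed

text \<open>
  By the two preceding lemmas, an edge that does not lead away from the root ends either at the
  parent of its start or at a vertex with the same parent.  Let \<open>m\<close> be the middle vertex of a path
  of length 2 from \<open>v\<close> to \<open>a\<close>.  If \<open>m = p\<close>, nothing is left to show; if \<open>m\<close> is another vertex
  with parent \<open>p\<close>, then the edge from \<open>m\<close> to \<open>a\<close> does not lead away from the root; and if \<open>m\<close>
  is farther than \<open>v\<close>, then \<open>v\<close> is its parent and the second edge would have to return to \<open>v\<close>.
\<close>

lemma second_neighbour_in_parent_ball:
  assumes v: "(r, v) \<in> E\<^sup>*" and p: "(p, v) \<in> E" "level E r v = Suc (level E r p)"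
    and near: "(v, a) \<in> E \<or> (\<exists>m. (m, v) \<in> E \<and> (m, a) \<in> E)"
    and le: "level E r a \<le> level E r v" and "a \<noteq> v"
  shows "a = p \<or> (p, a) \<in> E"
proof -
  \<comment> \<open>An edge from a vertex \<open>x\<close> with parent \<open>p\<close> to a vertex that is not farther than \<open>x\<close>
    stays in the closed neighbourhood of \<open>p\<close>.\<close>
  have step: "y = p \<or> (p, y) \<in> E"
    if x: "(r, x) \<in> E\<^sup>*" "(p, x) \<in> E" "level E r x = Suc (level E r p)"
      and y: "(x, y) \<in> E" "level E r y \<le> level E r x" for x y
  proof (cases "level E r y = level E r x")
    case True
    then show ?thesis using parent_of_level_neighbour[OF x(1) y(1) _ x(2,3)] by simp
  next
    case False
    have "level E r x \<le> Suc (level E r y)"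
      using level_edge_le[OF reach_edge[OF x(1) y(1)] symD_E[OF y(1)]] .
    with False y(2) have "level E r x = Suc (level E r y)" by simp
    then have "y = p"
      using x(3) by (rule parent_unique[OF x(1) symD_E[OF y(1)] x(2)])
    then show ?thesis ..
  qed
  from near show ?thesis
  proof
    assume "(v, a) \<in> E"
    then show ?thesis using step[OF v p _ le] by blast
  next
    assume "\<exists>m. (m, v) \<in> E \<and> (m, a) \<in> E"
    then obtain m where m: "(m, v) \<in> E" "(m, a) \<in> E" by blast
    have reach_m: "(r, m) \<in> E\<^sup>*"
      using v m(1) by (metis reach_edge symD_E)
    show ?thesis
    proof (cases "level E r m \<le> level E r v")
      case True
      from step[OF v p symD_E[OF m(1)] True] show ?thesis
      proof
        assume "m = p"
        with m(2) show ?thesis by simp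
      next
        assume pm: "(p, m) \<in> E"
        show ?thesis
        proof (cases "level E r m = level E r v")
          case True
          then show ?thesis using step[OF reach_m pm _ m(2)] p(2) le by simp
        next
          case False
          have "level E r v \<le> Suc (level E r m)"
            using level_edge_le[OF reach_m m(1)] .
          with False True have "level E r v = Suc (level E r m)" by simp
          then have "m = p"
            using p(2) by (rule parent_unique[OF v m(1) p(1)])
          with m(2) show ?thesis by simp
        qed
      qed
    next
      \<comment> \<open>If \<open>m\<close> is a child of \<open>v\<close>, then \<open>a\<close> would be a second parent of \<open>m\<close>.\<close>
      case False
      have "level E r m \<le> Suc (level E r v)"
        using level_edge_le[OF v symD_E[OF m(1)]] .
      moreover have "level E r m \<le> Suc (level E r a)"
        using level_edge_le[OF reach_edge[OF reach_m m(2)] symD_E[OF m(2)]] .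
      ultimately have "level E r m = Suc (level E r a)" "level E r m = Suc (level E r v)"
        using False le by simp_all
      then have "a = v"
        by (rule parent_unique[OF reach_m symD_E[OF m(2)] symD_E[OF m(1)]])
      with \<open>a \<noteq> v\<close> show ?thesis by simp
    qed
  qed
qed

lemma farthest_vertex_simplicial_in_square:
  assumes v: "(r, v) \<in> E\<^sup>*"
    and a: "(v, a) \<in> E \<or> (\<exists>m. (m, v) \<in> E \<and> (m, a) \<in> E)"
      "level E r a \<le> level E r v" "a \<noteq> v"
    and b: "(v, b) \<in> E \<or> (\<exists>m. (m, v) \<in> E \<and> (m, b) \<in> E)"
      "level E r b \<le> level E r v" "b \<noteq> v"
    and "a \<noteq> b"
  shows "(a, b) \<in> E \<or> (\<exists>m. (m, a) \<in> E \<and> (m, b) \<in> E)"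
proof (cases "level E r v")
  case 0
  have "(r, a) \<in> E\<^sup>*"
    using a(1) v by (metis reach_edge symD_E)
  with 0 a(2,3) v show ?thesis by (auto dest: level_eq_0D)
next
  case (Suc n)
  then obtain p where p: "(p, v) \<in> E" "level E r v = Suc (level E r p)"
    using obtain_parent[OF v] by metis
  from second_neighbour_in_parent_ball[OF v p a] second_neighbour_in_parent_ball[OF v p b] \<open>a \<noteq> b\<close>
  show ?thesis using symD_E[of p a] by auto
qed

end

section \<open>Cycles of a block graph span cliques\<close>

lemma rtrancl_on_imp_distinct_path:
  assumes "(u, v) \<in> rtrancl_on T E"
  shows "\<exists>xs. xs \<noteq> [] \<and> distinct xs \<and> hd xs = u \<and> last xs = v \<and> set xs \<subseteq> T
    \<and> successively (\<lambda>x y. (x, y) \<in> E) xs"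
  using assms
proof (induction rule: rtrancl_on_induct)
  case base
  then show ?case by (intro exI[of _ "[u]"]) auto
next
  case (step y z)
  then obtain xs where xs: "xs \<noteq> []" "distinct xs" "hd xs = u" "last xs = y" "set xs \<subseteq> T"
    "successively (\<lambda>x y. (x, y) \<in> E) xs" by blast
  show ?case
  proof (cases "z \<in> set xs")
    case True
    then obtain ys zs where "xs = ys @ z # zs" by (auto simp: in_set_conv_decomp)
    with xs show ?thesis
      by (intro exI[of _ "ys @ [z]"]) (auto simp: successively_append_iff hd_append split: if_splits)
  next
    case False
    with xs step(2,4) show ?thesis
      by (intro exI[of _ "xs @ [z]"]) (auto simp: successively_append_iff)
  qed
qed

lemma path_vertices_linked:
  assumes "sym E" "successively (\<lambda>x y. (x, y) \<in> E) xs" "set xs \<subseteq> T" "x \<in> set xs" "y \<in> set xs"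
  shows "(x, y) \<in> rtrancl_on T E"
proof -
  have from_hd: "(hd xs, z) \<in> rtrancl_on T E" if "z \<in> set xs" for z
    using assms(2,3) that
  proof (induction xs arbitrary: z rule: rev_induct)
    case (snoc a xs)
    show ?case
    proof (cases "xs = []")
      case True
      with snoc.prems show ?thesis by auto
    next
      case False
      then have "(hd xs, last xs) \<in> rtrancl_on T E" "(last xs, a) \<in> E" "a \<in> T"
        using snoc by (auto simp: successively_append_iff)
      then have "(hd xs, a) \<in> rtrancl_on T E" by (rule rtrancl_on_into_rtrancl_on)
      with False snoc show ?thesis by (auto simp: successively_append_iff)
    qed
  qed simp
  have "(x, hd xs) \<in> rtrancl_on T E"
    using from_hd[OF assms(4)] rtrancl_on_sym[OF assms(1)] by (blast dest: symD)
  then show ?thesis using from_hd[OF assms(5)] by (rule rtrancl_on_trans)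
qed

text \<open>
  The path \<open>xs\<close> closed up by \<open>w\<close> is a cycle.  If \<open>z\<close> lies on the path, then each of the two
  pieces of the path left by \<open>z\<close> keeps the end that is joined to \<open>w\<close>; otherwise the whole
  path remains.
\<close>

lemma cycle_minus_vertex_linked:
  assumes E: "sym E" and xs: "distinct xs" "successively (\<lambda>x y. (x, y) \<in> E) xs" "w \<notin> set xs"
    and ends: "xs \<noteq> []" "(w, hd xs) \<in> E" "(w, last xs) \<in> E"
    and S: "S = insert w (set xs)" and x: "x \<in> S - {z}" and y: "y \<in> S - {z}"
  shows "(x, y) \<in> rtrancl_on (S - {z}) E"
proof (cases "z \<in> set xs")
  case True
  then obtain ys zs where split: "xs = ys @ z # zs" by (auto simp: in_set_conv_decomp)
  have w: "w \<in> S - {z}" using S xs(3) True by auto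
  have sub: "set ys \<subseteq> S - {z}" "set zs \<subseteq> S - {z}" using S xs(1) split by auto
  have paths: "successively (\<lambda>x y. (x, y) \<in> E) ys" "successively (\<lambda>x y. (x, y) \<in> E) zs"
    using xs(2) split by (auto simp: successively_append_iff successively_Cons)
  have linked: "(w, v) \<in> rtrancl_on (S - {z}) E" if v: "v \<in> S - {z}" for v
  proof -
    have step: "(w, t) \<in> rtrancl_on (S - {z}) E" if "t \<in> S - {z}" "(w, t) \<in> E" for t
      using that w by (auto intro: rtrancl_on_into_rtrancl_on)
    consider "v = w" | "v \<in> set ys" | "v \<in> set zs"
      using v S split by auto
    then show ?thesis
    proof cases
      case 1
      with w show ?thesis by simp
    next
      case 2
      then have "hd ys \<in> set ys" "(w, hd ys) \<in> E"
        using ends(2) split by (cases ys; simp)+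
      moreover have "(hd ys, v) \<in> rtrancl_on (S - {z}) E"
        using path_vertices_linked[OF E paths(1) sub(1) _ 2] 2 by (cases ys) auto
      ultimately show ?thesis using step sub(1) by (blast intro: rtrancl_on_trans)
    next
      case 3
      then have "last zs \<in> set zs" "(w, last zs) \<in> E"
        using ends(3) split by (auto simp: last_append split: if_splits)
      moreover have "(last zs, v) \<in> rtrancl_on (S - {z}) E"
        using path_vertices_linked[OF E paths(2) sub(2) _ 3] calculation(1) by blast
      ultimately show ?thesis using step sub(2) by (blast intro: rtrancl_on_trans)
    qed
  qed
  then have "(x, w) \<in> rtrancl_on (S - {z}) E"
    using x rtrancl_on_sym[OF E] by (blast dest: symD)
  then show ?thesis using linked[OF y] by (rule rtrancl_on_trans)
next
  case False
  have sub: "set xs \<subseteq> S - {z}" using False S by auto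
  have to_hd: "(v, hd xs) \<in> rtrancl_on (S - {z}) E" if v: "v \<in> S - {z}" for v
  proof (cases "v = w")
    case True
    have "hd xs \<in> S - {z}" using sub ends(1) hd_in_set by blast
    with v True ends(2) show ?thesis by (auto intro: rtrancl_on_into_rtrancl_on)
  next
    case False
    then have "v \<in> set xs" using v S by auto
    then show ?thesis using path_vertices_linked[OF E xs(2) sub] ends(1) by simp
  qed
  then have "(hd xs, y) \<in> rtrancl_on (S - {z}) E"
    using y rtrancl_on_sym[OF E] by (blast dest: symD)
  with to_hd[OF x] show ?thesis by (rule rtrancl_on_trans)
qed

lemma rtrancl_on_restrict:
  assumes "(x, y) \<in> rtrancl_on T E" "E \<inter> T \<times> T \<subseteq> F"
  shows "(x, y) \<in> rtrancl_on T F"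
  using assms(1)
proof (induction rule: rtrancl_on_induct)
  case (step y z)
  with assms(2) have "(y, z) \<in> F" by blast
  with step show ?case by (blast intro: rtrancl_on_into_rtrancl_on)
qed simp

text \<open>
  Among the subgraphs with property \<open>P\<close> that contain \<open>H\<close>, one with the greatest total number of
  vertices and arcs is maximal, because compatible subgraphs with equal vertex and arc sets are
  equal.
\<close>

lemma (in fin_digraph) extend_to_max_subgraph:
  assumes "subgraph H G" "P H"
  obtains B where "max_subgraph P B" "subgraph H B"
proof -
  define Q where "Q B \<longleftrightarrow> subgraph B G \<and> P B \<and> subgraph H B" for B
  define total where "total B = card (verts B) + card (arcs B)" for B :: "('a, 'b) pre_digraph"
  have "Q H" using assms subgraph_refl wf_digraph.subgraph_refl unfolding Q_def
    by (auto simp: subgraph_def compatible_def)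
  moreover have "\<forall>B. Q B \<longrightarrow> total B < Suc (card (verts G) + card (arcs G))"
    unfolding Q_def total_def by (auto simp: subgraph_def less_Suc_eq_le intro!: add_mono card_mono)
  ultimately obtain B where B: "Q B" "\<And>B'. Q B' \<Longrightarrow> total B' \<le> total B"
    using ex_has_greatest_nat[of Q H total] by metis
  have "B' = B" if B': "subgraph B B'" "subgraph B' G" "P B'" for B'
  proof -
    have "Q B'" using B' B(1) unfolding Q_def by (auto simp: subgraph_def compatible_def)
    with B(2) have le: "total B' \<le> total B" .
    have sub: "verts B \<subseteq> verts B'" "arcs B \<subseteq> arcs B'" using B'(1) by (auto simp: subgraph_def)
    have fin: "finite (verts B')" "finite (arcs B')"
      using B'(2) by (auto simp: subgraph_def intro: finite_subset)
    have "card (verts B) \<le> card (verts B')" "card (arcs B) \<le> card (arcs B')"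
      using sub fin by (auto intro: card_mono)
    with le have "card (verts B) = card (verts B')" "card (arcs B) = card (arcs B')"
      unfolding total_def by auto
    then have "verts B = verts B'" "arcs B = arcs B'"
      using card_subset_eq[OF fin(1) sub(1)] card_subset_eq[OF fin(2) sub(2)] by simp_all
    with B'(1) show ?thesis
      by (auto intro!: pre_digraph.equality simp: subgraph_def compatible_def)
  qed
  with B(1) have "max_subgraph P B"
    unfolding max_subgraph_def Q_def by blast
  with that B(1) show ?thesis unfolding Q_def by blast
qed

text \<open>
  The subgraph induced by \<open>S\<close> is connected without a cut vertex, so it extends to a block,
  which is complete.
\<close>

lemma block_graph_biconnected_set_clique:
  assumes "block_graph G" and S: "S \<subseteq> pverts G" "S \<noteq> {}"
    and linked: "\<And>x y. x \<in> S \<Longrightarrow> y \<in> S \<Longrightarrow> (x, y) \<in> rtrancl_on S (parcs G)"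
    and linked': "\<And>z x y. z \<in> S \<Longrightarrow> x \<in> S - {z} \<Longrightarrow> y \<in> S - {z}
      \<Longrightarrow> (x, y) \<in> rtrancl_on (S - {z}) (parcs G)"
    and uv: "u \<in> S" "v \<in> S" "u \<noteq> v"
  shows "(u, v) \<in> parcs G"
proof -
  interpret pair_graph G using assms(1) by (simp add: block_graph_def)
  let ?H = "with_proj G \<restriction> S"
  have ends: "arcs_ends ?H = parcs G \<inter> S \<times> S"
    by (auto simp: arcs_ends_conv image_iff)
  have sub: "subgraph ?H (with_proj G)"
    using S(1) by (intro subgraph_induce_subgraphI) simp
  interpret H: wf_digraph ?H by blast
  have "sym (arcs_ends ?H)"
    unfolding ends using pair_sym_arcs by (auto simp: symmetric_def sym_def)
  then have "graph ?H"
    using S(1) pair_finite_arcs finite_subset[OF S(1) pair_finite_verts]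
    by unfold_locales (auto simp: arc_to_ends_def symmetric_def no_loops')
  moreover have "connected ?H"
    unfolding connected_def strongly_connected_def reachable_def with_proj_simps
  proof (intro conjI ballI)
    show "pverts (mk_symmetric ?H) \<noteq> {}" using S(2) by (simp add: mk_symmetric_def)
    fix x y assume "x \<in> pverts (mk_symmetric ?H)" "y \<in> pverts (mk_symmetric ?H)"
    then have "(x, y) \<in> rtrancl_on S (parcs G)"
      using linked by (simp add: mk_symmetric_def)
    then have "(x, y) \<in> rtrancl_on S (parcs (mk_symmetric ?H))"
      by (rule rtrancl_on_restrict) (auto simp: mk_symmetric_def)
    then show "(x, y) \<in> rtrancl_on (pverts (mk_symmetric ?H)) (parcs (mk_symmetric ?H))"
      by (simp add: mk_symmetric_def)
  qed
  moreover have "\<nexists>z. cut_vertex ?H z"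
  proof
    assume "\<exists>z. cut_vertex ?H z"
    then obtain z x y where z: "z \<in> S" and x: "x \<in> S - {z}" and y: "y \<in> S - {z}"
      and cut: "\<not> x \<rightarrow>\<^sup>*\<^bsub>pre_digraph.del_vert ?H z\<^esub> y"
      unfolding cut_vertex_def by auto
    have "(x, y) \<in> rtrancl_on (S - {z}) (arcs_ends (pre_digraph.del_vert ?H z))"
      using linked'[OF z x y]
      by (rule rtrancl_on_restrict) (auto simp: arcs_ends_conv pre_digraph.del_vert_def image_iff)
    with cut show False by (simp add: reachable_def pre_digraph.del_vert_def)
  qed
  ultimately obtain B where B: "block G B" "subgraph ?H B"
    using extend_to_max_subgraph[OF sub, of "\<lambda>H. graph H \<and> connected H \<and> (\<nexists>v. cut_vertex H v)"]
    unfolding block_def by blast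
  obtain n where "complete_digraph n B"
    using assms(1) B(1) unfolding block_graph_def by blast
  moreover have "u \<in> verts B" "v \<in> verts B"
    using uv B(2) by (auto simp: subgraph_def)
  ultimately have "(u, v) \<in> arcs_ends B"
    using uv(3) by (simp add: complete_digraph_def)
  moreover have "subgraph B (with_proj G)"
    using B(1) by (simp add: block_def max_subgraph_def)
  ultimately show ?thesis
    by (auto simp: arcs_ends_def arc_to_ends_def subgraph_def compatible_def)
qed

lemma block_graph_cycle_clique_relation:
  assumes "block_graph G"
  shows "cycle_clique_relation (parcs G)"
proof -
  interpret pair_graph G using assms by (simp add: block_graph_def)
  have sym: "sym (parcs G)" using pair_sym_arcs by (simp add: symmetric_def)
  show ?thesis
  proof
    show "sym (parcs G)" by fact
    show "(x, x) \<notin> parcs G" for x using no_loops' by blast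
    fix w u v
    assume w: "(w, u) \<in> parcs G" "(w, v) \<in> parcs G" and "u \<noteq> v"
      and uv: "(u, v) \<in> rtrancl_on (- {w}) (parcs G)"
    obtain xs where xs: "xs \<noteq> []" "distinct xs" "hd xs = u" "last xs = v" "w \<notin> set xs"
      "successively (\<lambda>x y. (x, y) \<in> parcs G) xs"
      using rtrancl_on_imp_distinct_path[OF uv] by blast
    define S where "S = insert w (set xs)"
    have uS: "u \<in> S" "v \<in> S" "w \<in> S"
      using xs hd_in_set[of xs] last_in_set[of xs] unfolding S_def by auto
    note linked' = cycle_minus_vertex_linked[OF sym xs(2,6,5,1) w[folded xs(3,4)] S_def]
    have linked: "(x, y) \<in> rtrancl_on S (parcs G)" if "x \<in> S" "y \<in> S" for x y
    proof -
      have "set xs \<subseteq> S" by (auto simp: S_def)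
      then have hd: "(hd xs, z) \<in> rtrancl_on S (parcs G)" if "z \<in> set xs" for z
        using path_vertices_linked[OF sym xs(6) _ _ that] xs(1) by simp
      have "(w, hd xs) \<in> rtrancl_on S (parcs G)"
        using uS w(1) xs(3) by (auto intro: rtrancl_on_into_rtrancl_on)
      then have hd': "(hd xs, z) \<in> rtrancl_on S (parcs G)" if "z \<in> S" for z
        using that hd rtrancl_on_sym[OF sym] unfolding S_def by (blast dest: symD)
      then have "(x, hd xs) \<in> rtrancl_on S (parcs G)"
        using \<open>x \<in> S\<close> rtrancl_on_sym[OF sym] by (blast dest: symD)
      then show ?thesis using hd'[OF \<open>y \<in> S\<close>] by (rule rtrancl_on_trans)
    qed
    have "S \<subseteq> pverts G"
    proof
      fix y assume "y \<in> S"
      then have "(w, y) \<in> rtrancl_on S (parcs G)" using linked uS(3) by blast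
      then show "y \<in> pverts G"
        by (cases rule: rtrancl_on.cases) (use w in \<open>auto dest: in_arcsD1 in_arcsD2\<close>)
    qed
    with linked linked' uS \<open>u \<noteq> v\<close> show "(u, v) \<in> parcs G"
      by (intro block_graph_biconnected_set_clique[OF assms, of S]) auto
  qed
qed

section \<open>Cycles of the second power\<close>

lemma second_power_arc_iff:
  assumes "pair_graph G"
  shows "(x, y) \<in> parcs (second_power G) \<longleftrightarrow>
    x \<noteq> y \<and> ((x, y) \<in> parcs G \<or> (\<exists>m. (m, x) \<in> parcs G \<and> (m, y) \<in> parcs G))"
proof -
  interpret pair_graph G by fact
  show ?thesis
    unfolding second_power_def open_nbhd_def by (auto dest: no_loops' in_arcsD1 in_arcsD2)
qed

lemma pair_graph_second_power:
  assumes "pair_graph G"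
  shows "pair_graph (second_power G)"
proof -
  interpret pair_graph G by fact
  have verts: "pverts (second_power G) = pverts G" by (simp add: second_power_def)
  have sub: "parcs (second_power G) \<subseteq> pverts G \<times> pverts G"
    by (auto simp: second_power_arc_iff[OF assms] dest: in_arcsD1 in_arcsD2)
  have "finite (parcs (second_power G))"
    using finite_subset[OF sub] pair_finite_verts by simp
  with sub pair_finite_verts show ?thesis
    by unfold_locales
      (auto simp: verts symmetric_def sym_def second_power_arc_iff[OF assms] dest: arcs_symmetric)
qed

lemma add_mod_neq_self:
  fixes i k n :: nat
  assumes "i < n" "0 < k" "k < n"
  shows "(i + k) mod n \<noteq> i"
proof (cases "i + k < n")
  case False
  with assms have "(i + k) mod n = i + k - n" by (simp add: mod_if)
  with assms False show ?thesis by linarith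
qed (use assms in simp)

text \<open>
  Reading the indices modulo the length makes the predecessor and the successor of a vertex
  uniformly available, wherever the list of arcs happens to start.
\<close>

lemma (in pre_digraph) cycle_arcs_indexed:
  assumes "cycle c"
  shows "distinct (map (tail G) c)"
    and "i < length c \<Longrightarrow> head G (c ! i) = tail G (c ! (Suc i mod length c))"
proof -
  obtain u where u: "awalk u c u" "distinct (tl (awalk_verts u c))" "c \<noteq> []"
    using assms unfolding cycle_def by blast
  have heads: "awalk_verts u c = u # map (head G) c"
    using u awalk_verts_conv'[of u c u] by (cases c) (auto simp: awalk_def)
  have tails: "awalk_verts u c = map (tail G) c @ [u]"
    using u awalk_verts_conv[of u c] heads by (cases c rule: rev_cases) (auto simp: awalk_def)
  have eq: "u # map (head G) c = map (tail G) c @ [u]"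
    using heads tails by simp
  then have "mset (u # map (head G) c) = mset (map (tail G) c @ [u])" by simp
  then have "mset (map (head G) c) = mset (map (tail G) c)" by simp
  moreover have "distinct (map (head G) c)" using u(2) heads by simp
  ultimately show "distinct (map (tail G) c)" by (metis mset_eq_imp_distinct_iff)
  assume i: "i < length c"
  have "head G (c ! i) = (u # map (head G) c) ! Suc i" using i by simp
  also have "\<dots> = (map (tail G) c @ [u]) ! Suc i" by (simp only: eq)
  also have "\<dots> = tail G (c ! (Suc i mod length c))"
  proof (cases "Suc i = length c")
    case True
    have "u = tail G (c ! 0)" using arg_cong[OF eq, of hd] u(3) by (cases c) auto
    with True show ?thesis by (simp add: nth_append)
  qed (use i in \<open>simp add: nth_append\<close>)
  finally show "head G (c ! i) = tail G (c ! (Suc i mod length c))" .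
qed

theorem proposition4p6:
  fixes G :: "'a pair_pre_digraph"
  assumes "pair_graph G"
    and "no_isolated_verts G"
    and "block_graph G"
  shows "chordal (second_power G)"
  unfolding chordal_def
proof (intro conjI allI impI)
  show "pair_graph (second_power G)"
    using assms(1) by (rule pair_graph_second_power)
  interpret cycle_clique_relation "parcs G"
    using assms(3) by (rule block_graph_cycle_clique_relation)
  note arc_iff = second_power_arc_iff[OF assms(1)]
  fix c
  assume c: "pre_digraph.cycle (with_proj (second_power G)) c \<and> 4 \<le> length c"
  define n where "n = length c"
  have n: "4 \<le> n" using c n_def by simp
  define x where "x i = fst (c ! (i mod n))" for i
  have mod_n: "i mod n < n" for i using n by simp
  have arc: "c ! (i mod n) = (x i, x (Suc i))" for i
    using pre_digraph.cycle_arcs_indexed(2)[of "second_power G" c "i mod n"] c n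
      mod_n[of i]
    by (cases "c ! (i mod n)") (simp add: x_def n_def mod_Suc_eq)
  have dist: "distinct (map fst c)"
    using pre_digraph.cycle_arcs_indexed(1)[of "second_power G" c] c by simp
  have x_eq_iff: "x i = x j \<longleftrightarrow> i mod n = j mod n" for i j
    using dist mod_n[of i] mod_n[of j] nth_eq_iff_index_eq[of "map fst c" "i mod n" "j mod n"]
    by (simp add: x_def n_def)
  have set_c: "e \<in> set c \<longleftrightarrow> (\<exists>i. e = (x i, x (Suc i)))" for e
  proof
    assume "e \<in> set c"
    then obtain i where "i < n" "e = c ! i" by (auto simp: n_def in_set_conv_nth)
    with arc[of i] show "\<exists>i. e = (x i, x (Suc i))" by auto
  next
    assume "\<exists>i. e = (x i, x (Suc i))"
    then obtain i where "e = c ! (i mod n)" using arc by auto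
    with mod_n[of i] show "e \<in> set c" by (simp add: n_def)
  qed
  have verts_c: "fst ` set c = range x"
    unfolding set_eq_iff image_iff Bex_def set_c by auto
  have adj: "(x i, x (Suc i)) \<in> parcs (second_power G)" for i
  proof -
    have "set c \<subseteq> parcs (second_power G)"
      using c by (auto simp: pre_digraph.cycle_def pre_digraph.awalk_def)
    then show ?thesis using set_c by blast
  qed
  have reach: "(x 0, x i) \<in> (parcs G)\<^sup>*" for i
  proof (induction i)
    case (Suc i)
    have "(x i, x (Suc i)) \<in> (parcs G)\<^sup>*"
      using adj[of i] unfolding arc_iff by (metis symD_E r_into_rtrancl rtrancl_into_rtrancl)
    with Suc.IH show ?case by (rule rtrancl_trans)
  qed simp
  let ?l = "level (parcs G) (x 0)"
  define L where "L = range (\<lambda>i. ?l (x i))"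
  have "L = ?l ` fst ` set c"
    unfolding L_def verts_c by (simp add: image_image)
  then have L: "finite L" "L \<noteq> {}"
    by (auto simp: L_def)
  then obtain k where "Max L = ?l (x k)"
    using Max_in[OF L] unfolding L_def by blast
  then have k: "?l (x i) \<le> ?l (x k)" for i
    using Max_ge[OF L(1), of "?l (x i)"] unfolding L_def by simp
  \<comment> \<open>The index before \<open>k\<close> modulo \<open>n\<close>; adding \<open>n - 1\<close> avoids subtracting from \<open>k = 0\<close>.\<close>
  define j where "j = k + (n - 1)"
  have xk: "x k = x (Suc j)" unfolding x_eq_iff j_def using n by simp
  have neq: "x i \<noteq> x (i + m)" if "0 < m" "m < n" for i m
    using add_mod_neq_self[of "i mod n" n m] that by (auto simp: x_eq_iff mod_add_left_eq)
  let ?a = "x j" and ?v = "x (Suc j)" and ?b = "x (Suc (Suc j))"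
  \<comment> \<open>The last inequality is where length at least 4 is needed: in a triangle, \<open>?a\<close> follows
    \<open>?b\<close>.\<close>
  have distinct: "?a \<noteq> ?v" "?v \<noteq> ?b" "?a \<noteq> ?b" "x (Suc (Suc (Suc j))) \<noteq> ?a"
    using neq[of 1 j] neq[of 1 "Suc j"] neq[of 2 j] neq[of 3 j] n by (simp_all add: eval_nat_numeral)
  have near: "(?v, ?a) \<in> parcs G \<or> (\<exists>m. (m, ?v) \<in> parcs G \<and> (m, ?a) \<in> parcs G)"
    "(?v, ?b) \<in> parcs G \<or> (\<exists>m. (m, ?v) \<in> parcs G \<and> (m, ?b) \<in> parcs G)"
    using adj[of j] adj[of "Suc j"] unfolding arc_iff by (auto dest: symD_E)
  have farthest: "?l y \<le> ?l ?v" if "y \<in> range x" for y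
    using that k xk by auto
  have "(?a, ?b) \<in> parcs G \<or> (\<exists>m. (m, ?a) \<in> parcs G \<and> (m, ?b) \<in> parcs G)"
    using distinct farthest by (intro farthest_vertex_simplicial_in_square[OF reach near(1) _ _ near(2)]) auto
  with distinct(3) have "(?a, ?b) \<in> parcs (second_power G)"
    unfolding arc_iff by blast
  moreover have succ: "y = x (Suc i)" if e: "(x i, y) \<in> set c" for i y
  proof -
    obtain i' where "x i = x i'" "y = x (Suc i')" using e unfolding set_c by blast
    then show ?thesis unfolding x_eq_iff by (metis mod_Suc_eq x_eq_iff)
  qed
  have "(?a, ?b) \<notin> set c" "(?b, ?a) \<notin> set c"
    using succ distinct by metis+
  ultimately have "chord (second_power G) c (?a, ?b)"
    unfolding chord_def verts_c by simp
  then show "\<exists>e. chord (second_power G) c e" ..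
qed

end
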